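(* Let $\mathcal{C}$ be an abelian category, let $\mathcal{C}_{\ell<\infty}\subseteq\mathcal{C}$ be a Serre subcategory, and let $\ell$ be a length function on $\mathcal{C}_{\ell<\infty}$, i.e. a function from the objects of $\mathcal{C}_{\ell<\infty}$ to an abelian group such that $\ell(X)=\ell(X')+\ell(X'')$ for every short exact sequence $0\to X'\to X\to X''\to 0$ in $\mathcal{C}_{\ell<\infty}$. Let $f:A\to B$ and $g:B\to C$ be morphisms in $\mathcal{C}$. If $f$, $g$ and $gf$ are all Fredholm morphisms, then $$\operatorname{ind}(gf)=\operatorname{ind} (f)+\operatorname{ind} (g).$$
   Context: A morphism $u:X\to Y$ in $\mathcal{C}$ is called Fredholm if $\ker u$ and $\operatorname{cok} u$ (the cokernel of $u$) are both in $\mathcal{C}_{\ell<\infty}$. The index of a Fredholm morphism $u$ is $\operatorname{ind}(u)=\ell(\operatorname{cok} u)-\ell(\ker u)$. A Serre subcategory is a nonempty full subcategory closed under subobjects, quotients and extensions. *)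

theory Defs
  imports Main "HOL-Algebra.Group"
begin

text \<open>The morphisms \<open>X \<rightarrow> Y\<close> are the members of \<open>Arr\<close> with domain \<open>X\<close> and
  codomain \<open>Y\<close>. Composition and addition are unspecified outside composable,
  respectively parallel, pairs.\<close>

record ('o, 'm) preadd_category =
  Obj :: "'o set"
  Arr :: "'m set"
  Dom :: "'m \<Rightarrow> 'o"
  Cod :: "'m \<Rightarrow> 'o"
  ident :: "'o \<Rightarrow> 'm"
  Comp :: "'m \<Rightarrow> 'm \<Rightarrow> 'm" (infixr "\<cdot>\<index>" 70)
  Add :: "'m \<Rightarrow> 'm \<Rightarrow> 'm" (infixl "\<boxplus>\<index>" 65)
  Zero :: "'o \<Rightarrow> 'o \<Rightarrow> 'm"

definition Hom :: "('o, 'm, 'z) preadd_category_scheme \<Rightarrow> 'o \<Rightarrow> 'o \<Rightarrow> 'm set" where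
  "Hom C X Y = {f \<in> Arr C. Dom C f = X \<and> Cod C f = Y}"

definition Hom_group :: "('o, 'm, 'z) preadd_category_scheme \<Rightarrow> 'o \<Rightarrow> 'o \<Rightarrow> 'm monoid" where
  "Hom_group C X Y = \<lparr>carrier = Hom C X Y, monoid.mult = Add C, one = Zero C X Y\<rparr>"

locale cat =
  fixes C :: "('o, 'm, 'z) preadd_category_scheme" (structure)
  assumes Dom_in_Obj: "f \<in> Arr C \<Longrightarrow> Dom C f \<in> Obj C"
    and Cod_in_Obj: "f \<in> Arr C \<Longrightarrow> Cod C f \<in> Obj C"
    and ident_in_Hom: "X \<in> Obj C \<Longrightarrow> ident C X \<in> Hom C X X"
    and Comp_in_Hom: "f \<in> Hom C X Y \<Longrightarrow> g \<in> Hom C Y Z \<Longrightarrow> g \<cdot> f \<in> Hom C X Z"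
    and Comp_assoc: "f \<in> Hom C W X \<Longrightarrow> g \<in> Hom C X Y \<Longrightarrow> h \<in> Hom C Y Z \<Longrightarrow>
      (h \<cdot> g) \<cdot> f = h \<cdot> (g \<cdot> f)"
    and Comp_ident_right: "f \<in> Hom C X Y \<Longrightarrow> f \<cdot> ident C X = f"
    and Comp_ident_left: "f \<in> Hom C X Y \<Longrightarrow> ident C Y \<cdot> f = f"

locale preadditive_category = cat +
  assumes Hom_comm_group: "X \<in> Obj C \<Longrightarrow> Y \<in> Obj C \<Longrightarrow> comm_group (Hom_group C X Y)"
    and Comp_Add_left: "f \<in> Hom C X Y \<Longrightarrow> g \<in> Hom C Y Z \<Longrightarrow> h \<in> Hom C Y Z \<Longrightarrow>
      (g \<boxplus> h) \<cdot> f = (g \<cdot> f) \<boxplus> (h \<cdot> f)"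
    and Comp_Add_right: "f \<in> Hom C X Y \<Longrightarrow> g \<in> Hom C X Y \<Longrightarrow> h \<in> Hom C Y Z \<Longrightarrow>
      h \<cdot> (f \<boxplus> g) = (h \<cdot> f) \<boxplus> (h \<cdot> g)"

definition zero_object :: "('o, 'm, 'z) preadd_category_scheme \<Rightarrow> 'o \<Rightarrow> bool" where
  "zero_object C Z \<longleftrightarrow> Z \<in> Obj C \<and>
     (\<forall>X\<in>Obj C. (\<exists>!f. f \<in> Hom C X Z) \<and> (\<exists>!f. f \<in> Hom C Z X))"

definition is_biproduct ::
  "('o, 'm, 'z) preadd_category_scheme \<Rightarrow> 'o \<Rightarrow> 'o \<Rightarrow> 'o \<Rightarrow> 'm \<Rightarrow> 'm \<Rightarrow> 'm \<Rightarrow> 'm \<Rightarrow> bool" where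
  "is_biproduct C X Y P i1 i2 p1 p2 \<longleftrightarrow>
     i1 \<in> Hom C X P \<and> i2 \<in> Hom C Y P \<and> p1 \<in> Hom C P X \<and> p2 \<in> Hom C P Y \<and>
     p1 \<cdot>\<^bsub>C\<^esub> i1 = ident C X \<and> p2 \<cdot>\<^bsub>C\<^esub> i2 = ident C Y \<and>
     p1 \<cdot>\<^bsub>C\<^esub> i2 = Zero C Y X \<and> p2 \<cdot>\<^bsub>C\<^esub> i1 = Zero C X Y \<and>
     (i1 \<cdot>\<^bsub>C\<^esub> p1) \<boxplus>\<^bsub>C\<^esub> (i2 \<cdot>\<^bsub>C\<^esub> p2) = ident C P"

definition monic :: "('o, 'm, 'z) preadd_category_scheme \<Rightarrow> 'm \<Rightarrow> bool" where
  "monic C m \<longleftrightarrow> m \<in> Arr C \<and>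
     (\<forall>W. \<forall>g\<in>Hom C W (Dom C m). \<forall>h\<in>Hom C W (Dom C m).
        m \<cdot>\<^bsub>C\<^esub> g = m \<cdot>\<^bsub>C\<^esub> h \<longrightarrow> g = h)"

definition epic :: "('o, 'm, 'z) preadd_category_scheme \<Rightarrow> 'm \<Rightarrow> bool" where
  "epic C e \<longleftrightarrow> e \<in> Arr C \<and>
     (\<forall>W. \<forall>g\<in>Hom C (Cod C e) W. \<forall>h\<in>Hom C (Cod C e) W.
        g \<cdot>\<^bsub>C\<^esub> e = h \<cdot>\<^bsub>C\<^esub> e \<longrightarrow> g = h)"

definition is_kernel :: "('o, 'm, 'z) preadd_category_scheme \<Rightarrow> 'm \<Rightarrow> 'm \<Rightarrow> bool" where
  "is_kernel C k f \<longleftrightarrow> f \<in> Arr C \<and> k \<in> Arr C \<and> Cod C k = Dom C f \<and>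
     f \<cdot>\<^bsub>C\<^esub> k = Zero C (Dom C k) (Cod C f) \<and>
     (\<forall>W. \<forall>h\<in>Hom C W (Dom C f). f \<cdot>\<^bsub>C\<^esub> h = Zero C W (Cod C f) \<longrightarrow>
        (\<exists>!h'. h' \<in> Hom C W (Dom C k) \<and> k \<cdot>\<^bsub>C\<^esub> h' = h))"

definition is_cokernel :: "('o, 'm, 'z) preadd_category_scheme \<Rightarrow> 'm \<Rightarrow> 'm \<Rightarrow> bool" where
  "is_cokernel C q f \<longleftrightarrow> f \<in> Arr C \<and> q \<in> Arr C \<and> Dom C q = Cod C f \<and>
     q \<cdot>\<^bsub>C\<^esub> f = Zero C (Dom C f) (Cod C q) \<and>
     (\<forall>W. \<forall>h\<in>Hom C (Cod C f) W. h \<cdot>\<^bsub>C\<^esub> f = Zero C (Dom C f) W \<longrightarrow>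
        (\<exists>!h'. h' \<in> Hom C (Cod C q) W \<and> h' \<cdot>\<^bsub>C\<^esub> q = h))"

locale abelian_category = preadditive_category +
  assumes ex_zero_object: "\<exists>Z. zero_object C Z"
    and ex_biproduct: "X \<in> Obj C \<Longrightarrow> Y \<in> Obj C \<Longrightarrow>
      \<exists>P i1 i2 p1 p2. is_biproduct C X Y P i1 i2 p1 p2"
    and ex_kernel: "f \<in> Arr C \<Longrightarrow> \<exists>k. is_kernel C k f"
    and ex_cokernel: "f \<in> Arr C \<Longrightarrow> \<exists>q. is_cokernel C q f"
    and monic_is_kernel: "monic C m \<Longrightarrow> \<exists>f. is_kernel C m f"
    and epic_is_cokernel: "epic C e \<Longrightarrow> \<exists>f. is_cokernel C e f"

text \<open>Kernel and cokernel objects are unique only up to isomorphism; a representative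
  is chosen. Being in a Serre subcategory and the value of a length function are
  isomorphism invariant, so Fredholmness and the index do not depend on the choice.\<close>

definition ker :: "('o, 'm, 'z) preadd_category_scheme \<Rightarrow> 'm \<Rightarrow> 'o" where
  "ker C u = Dom C (SOME k. is_kernel C k u)"

definition cok :: "('o, 'm, 'z) preadd_category_scheme \<Rightarrow> 'm \<Rightarrow> 'o" where
  "cok C u = Cod C (SOME q. is_cokernel C q u)"

text \<open>Exactness of \<open>0 \<rightarrow> Dom i \<rightarrow> Cod i = Dom p \<rightarrow> Cod p \<rightarrow> 0\<close>.\<close>

definition short_exact :: "('o, 'm, 'z) preadd_category_scheme \<Rightarrow> 'm \<Rightarrow> 'm \<Rightarrow> bool" where
  "short_exact C i p \<longleftrightarrow> is_kernel C i p \<and> is_cokernel C p i"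

text \<open>Being full, a Serre subcategory is given by its set \<open>S\<close> of objects.\<close>

definition serre_subcategory :: "('o, 'm, 'z) preadd_category_scheme \<Rightarrow> 'o set \<Rightarrow> bool" where
  "serre_subcategory C S \<longleftrightarrow> S \<subseteq> Obj C \<and> S \<noteq> {} \<and>
     (\<forall>m. monic C m \<and> Cod C m \<in> S \<longrightarrow> Dom C m \<in> S) \<and>
     (\<forall>e. epic C e \<and> Dom C e \<in> S \<longrightarrow> Cod C e \<in> S) \<and>
     (\<forall>i p. short_exact C i p \<and> Dom C i \<in> S \<and> Cod C p \<in> S \<longrightarrow> Cod C i \<in> S)"

text \<open>The inclusion of a Serre subcategory is exact and reflects exactness, so a short exact
  sequence in \<open>S\<close> is a short exact sequence in \<open>C\<close> whose three objects lie in \<open>S\<close>.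
  Values of \<open>len\<close> outside \<open>S\<close> are irrelevant.\<close>

definition length_function ::
  "('o, 'm, 'z) preadd_category_scheme \<Rightarrow> 'o set \<Rightarrow> ('o \<Rightarrow> 'a::ab_group_add) \<Rightarrow> bool" where
  "length_function C S len \<longleftrightarrow>
     (\<forall>i p. short_exact C i p \<and> Dom C i \<in> S \<and> Cod C i \<in> S \<and> Cod C p \<in> S \<longrightarrow>
        len (Cod C i) = len (Dom C i) + len (Cod C p))"

definition Fredholm :: "('o, 'm, 'z) preadd_category_scheme \<Rightarrow> 'o set \<Rightarrow> 'm \<Rightarrow> bool" where
  "Fredholm C S u \<longleftrightarrow> u \<in> Arr C \<and> ker C u \<in> S \<and> cok C u \<in> S"

definition ind ::
  "('o, 'm, 'z) preadd_category_scheme \<Rightarrow> ('o \<Rightarrow> 'a::ab_group_add) \<Rightarrow> 'm \<Rightarrow> 'a" where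
  "ind C len u = len (cok C u) - len (ker C u)"

end

(* The lengths are compared along the exact sequence
     0 -> ker f -> ker gf -> ker g -> cok f -> cok gf -> cok g -> 0.
   Write m for the kernel of g, p for the cokernel of f, and let J, I, T be the kernel, the image
   and the cokernel of the middle map p m : ker g -> cok f. The sequence splits into
     0 -> ker f -> ker gf -> J -> 0,   0 -> J -> ker g -> I -> 0,
     0 -> I -> cok f -> T -> 0,        0 -> T -> cok gf -> cok g -> 0,
   where the last one is the first one read in the opposite category. Since J, I, T are subobjects
   or quotients of ker g and cok f, they lie in the Serre subcategory, and additivity of the length
   on the four sequences gives the claim. *)
theory Submission
  imports Defs
begin

section \<open>The opposite category\<close>

text \<open>Reversing the arrows lets every fact on kernels be reused for cokernels. Besides domain,
  codomain and composition, \<open>Zero\<close> has its arguments swapped, because a morphism from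
  \<open>X\<close> to \<open>Y\<close> in the opposite category is one from \<open>Y\<close> to
  \<open>X\<close> in \<open>C\<close>.\<close>

definition op_cat :: "('o, 'm, 'z) preadd_category_scheme \<Rightarrow> ('o, 'm, 'z) preadd_category_scheme"
  where "op_cat C = C\<lparr>Dom := Cod C, Cod := Dom C, Comp := \<lambda>g f. Comp C f g,
    Zero := \<lambda>X Y. Zero C Y X\<rparr>"

lemma op_cat_simps [simp]:
  "Obj (op_cat C) = Obj C" "Arr (op_cat C) = Arr C" "Dom (op_cat C) = Cod C"
  "Cod (op_cat C) = Dom C" "ident (op_cat C) = ident C"
  "g \<cdot>\<^bsub>op_cat C\<^esub> f = f \<cdot>\<^bsub>C\<^esub> g" "Add (op_cat C) = Add C" "Zero (op_cat C) X Y = Zero C Y X"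
  by (simp_all add: op_cat_def)

lemma Hom_op [simp]: "Hom (op_cat C) X Y = Hom C Y X"
  by (auto simp: Hom_def)

lemma Hom_group_op [simp]: "Hom_group (op_cat C) X Y = Hom_group C Y X"
  by (simp add: Hom_group_def)

lemma is_kernel_op [simp]: "is_kernel (op_cat C) k f \<longleftrightarrow> is_cokernel C k f"
  by (simp add: is_kernel_def is_cokernel_def)

lemma is_cokernel_op [simp]: "is_cokernel (op_cat C) q f \<longleftrightarrow> is_kernel C q f"
  by (simp add: is_kernel_def is_cokernel_def)

lemma monic_op [simp]: "monic (op_cat C) m \<longleftrightarrow> epic C m"
  by (simp add: monic_def epic_def)

lemma epic_op [simp]: "epic (op_cat C) e \<longleftrightarrow> monic C e"
  by (simp add: monic_def epic_def)

lemma zero_object_op [simp]: "zero_object (op_cat C) Z \<longleftrightarrow> zero_object C Z"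
  by (auto simp: zero_object_def)

lemma is_biproduct_op [simp]:
  "is_biproduct (op_cat C) X Y P i1 i2 p1 p2 \<longleftrightarrow> is_biproduct C X Y P p1 p2 i1 i2"
  by (auto simp: is_biproduct_def)

lemma short_exact_op [simp]: "short_exact (op_cat C) p i \<longleftrightarrow> short_exact C i p"
  by (auto simp: short_exact_def)

text \<open>The axioms are self-dual as a list: kernels pair with cokernels, monic with epic, and a
  biproduct remains one after its injections and projections are exchanged.\<close>

lemma (in abelian_category) abelian_op: "abelian_category (op_cat C)"
proof (intro abelian_category.intro preadditive_category.intro cat.intro
    preadditive_category_axioms.intro abelian_category_axioms.intro)
  fix X Y assume "X \<in> Obj (op_cat C)" "Y \<in> Obj (op_cat C)"
  then show "\<exists>P i1 i2 p1 p2. is_biproduct (op_cat C) X Y P i1 i2 p1 p2"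
    using ex_biproduct[of X Y] by (simp, blast)
qed (auto simp: Dom_in_Obj Cod_in_Obj ident_in_Hom Comp_in_Hom Comp_assoc Comp_ident_right
      Comp_ident_left Hom_comm_group Comp_Add_left Comp_Add_right ex_zero_object ex_kernel
      ex_cokernel monic_is_kernel epic_is_cokernel)

section \<open>Zero morphisms\<close>

context preadditive_category
begin

lemma Hom_Obj: "f \<in> Hom C X Y \<Longrightarrow> X \<in> Obj C \<and> Y \<in> Obj C"
  using Dom_in_Obj Cod_in_Obj by (auto simp: Hom_def)

lemma Zero_in_Hom: "X \<in> Obj C \<Longrightarrow> Y \<in> Obj C \<Longrightarrow> Zero C X Y \<in> Hom C X Y"
  using group.is_monoid[OF comm_group.axioms(2)[OF Hom_comm_group[of X Y]]]
    monoid.one_closed[of "Hom_group C X Y"] by (simp add: Hom_group_def)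

lemma Add_in_Hom: "f \<in> Hom C X Y \<Longrightarrow> g \<in> Hom C X Y \<Longrightarrow> f \<boxplus> g \<in> Hom C X Y"
  using group.is_monoid[OF comm_group.axioms(2)[OF Hom_comm_group[of X Y]]]
    monoid.m_closed[of "Hom_group C X Y" f g] Hom_Obj[of f X Y] by (simp add: Hom_group_def)

lemma Zero_Add: "f \<in> Hom C X Y \<Longrightarrow> Zero C X Y \<boxplus> f = f"
  using group.is_monoid[OF comm_group.axioms(2)[OF Hom_comm_group[of X Y]]]
    monoid.l_one[of "Hom_group C X Y" f] Hom_Obj[of f X Y] by (simp add: Hom_group_def)

lemma Add_Zero: "f \<in> Hom C X Y \<Longrightarrow> f \<boxplus> Zero C X Y = f"
  using group.is_monoid[OF comm_group.axioms(2)[OF Hom_comm_group[of X Y]]]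
    monoid.r_one[of "Hom_group C X Y" f] Hom_Obj[of f X Y] by (simp add: Hom_group_def)

lemma Add_right_cancel:
  "f \<in> Hom C X Y \<Longrightarrow> g \<in> Hom C X Y \<Longrightarrow> h \<in> Hom C X Y \<Longrightarrow> f \<boxplus> h = g \<boxplus> h \<Longrightarrow> f = g"
  using group.right_cancel[OF comm_group.axioms(2)[OF Hom_comm_group[of X Y]], of h f g]
    Hom_Obj[of f X Y] by (simp add: Hom_group_def)

lemma ex_neg:
  assumes "f \<in> Hom C X Y"
  obtains f' where "f' \<in> Hom C X Y" "f \<boxplus> f' = Zero C X Y"
  using group.inv_closed[OF comm_group.axioms(2)[OF Hom_comm_group[of X Y]], of f]
    group.r_inv[OF comm_group.axioms(2)[OF Hom_comm_group[of X Y]], of f]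
    Hom_Obj[OF assms] assms by (auto simp: Hom_group_def)

lemma Comp_Zero_left:
  assumes f: "f \<in> Hom C X Y" and Z: "Z \<in> Obj C"
  shows "Zero C Y Z \<cdot> f = Zero C X Z"
proof -
  have z: "Zero C Y Z \<in> Hom C Y Z" using Zero_in_Hom Hom_Obj[OF f] Z by blast
  have zf: "Zero C Y Z \<cdot> f \<in> Hom C X Z" using Comp_in_Hom[OF f z] .
  have "(Zero C Y Z \<cdot> f) \<boxplus> (Zero C Y Z \<cdot> f) = Zero C X Z \<boxplus> (Zero C Y Z \<cdot> f)"
    using Comp_Add_left[OF f z z] Zero_Add[OF z] Zero_Add[OF zf] by simp
  then show ?thesis
    using Add_right_cancel[OF zf _ zf] Zero_in_Hom Hom_Obj[OF zf] by blast
qed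

lemma Comp_Zero_right:
  assumes f: "f \<in> Hom C Y Z" and X: "X \<in> Obj C"
  shows "f \<cdot> Zero C X Y = Zero C X Z"
proof -
  have z: "Zero C X Y \<in> Hom C X Y" using Zero_in_Hom Hom_Obj[OF f] X by blast
  have fz: "f \<cdot> Zero C X Y \<in> Hom C X Z" using Comp_in_Hom[OF z f] .
  have "(f \<cdot> Zero C X Y) \<boxplus> (f \<cdot> Zero C X Y) = Zero C X Z \<boxplus> (f \<cdot> Zero C X Y)"
    using Comp_Add_right[OF z z f] Zero_Add[OF z] Zero_Add[OF fz] by simp
  then show ?thesis
    using Add_right_cancel[OF fz _ fz] Zero_in_Hom Hom_Obj[OF fz] by blast
qed

text \<open>Subtraction reduces cancellation to testing against zero: if \<open>g\<close> and
  \<open>h\<close> agree after \<open>e\<close>, then \<open>g \<boxplus> h'\<close>, with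
  \<open>h'\<close> the negative of \<open>h\<close>, kills \<open>e\<close>.\<close>

lemma epicI:
  assumes e: "e \<in> Hom C X Y"
    and *: "\<And>W h. h \<in> Hom C Y W \<Longrightarrow> h \<cdot> e = Zero C X W \<Longrightarrow> h = Zero C Y W"
  shows "epic C e"
  unfolding epic_def
proof (intro conjI allI ballI impI)
  show "e \<in> Arr C" using e by (simp add: Hom_def)
  fix W g h
  assume "g \<in> Hom C (Cod C e) W" "h \<in> Hom C (Cod C e) W" and eq: "g \<cdot> e = h \<cdot> e"
  then have g: "g \<in> Hom C Y W" and h: "h \<in> Hom C Y W" using e by (auto simp: Hom_def)
  obtain h' where h': "h' \<in> Hom C Y W" "h \<boxplus> h' = Zero C Y W" using ex_neg[OF h] .
  have "(g \<boxplus> h') \<cdot> e = (h \<boxplus> h') \<cdot> e"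
    using Comp_Add_left[OF e g h'(1)] Comp_Add_left[OF e h h'(1)] eq by simp
  also have "\<dots> = Zero C X W" using Comp_Zero_left[OF e] h'(2) Hom_Obj[OF h] by simp
  finally have "g \<boxplus> h' = Zero C Y W" using *[OF Add_in_Hom[OF g h'(1)]] by simp
  then show "g = h" using Add_right_cancel[OF g h h'(1)] h'(2) by simp
qed

lemma epic_zero:
  assumes "epic C e" "e \<in> Hom C X Y" "h \<in> Hom C Y W" "h \<cdot> e = Zero C X W"
  shows "h = Zero C Y W"
proof -
  have "Zero C Y W \<cdot> e = Zero C X W" using Comp_Zero_left assms Hom_Obj by blast
  moreover have "Zero C Y W \<in> Hom C Y W" using assms Zero_in_Hom Hom_Obj by blast
  ultimately show ?thesis using assms by (auto simp: epic_def Hom_def)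
qed

lemma monic_cancel:
  assumes "monic C m" "m \<in> Hom C X Y" "g \<in> Hom C W X" "h \<in> Hom C W X" "m \<cdot> g = m \<cdot> h"
  shows "g = h"
  using assms by (auto simp: monic_def Hom_def)

lemma monic_zero:
  assumes "monic C m" "m \<in> Hom C X Y" "h \<in> Hom C W X" "m \<cdot> h = Zero C W Y"
  shows "h = Zero C W X"
  using monic_cancel[OF assms(1-3), of "Zero C W X"] assms Comp_Zero_right Zero_in_Hom Hom_Obj
  by metis

lemma monic_Comp:
  assumes m: "monic C m" "m \<in> Hom C X Y" and n: "monic C n" "n \<in> Hom C Y Z"
  shows "monic C (n \<cdot> m)"
  unfolding monic_def
proof (intro conjI allI ballI impI)
  have nm: "n \<cdot> m \<in> Hom C X Z" using Comp_in_Hom[OF m(2) n(2)] .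
  then show "n \<cdot> m \<in> Arr C" by (simp add: Hom_def)
  fix W g h
  assume "g \<in> Hom C W (Dom C (n \<cdot> m))" "h \<in> Hom C W (Dom C (n \<cdot> m))"
    and eq: "(n \<cdot> m) \<cdot> g = (n \<cdot> m) \<cdot> h"
  then have g: "g \<in> Hom C W X" and h: "h \<in> Hom C W X" using nm by (auto simp: Hom_def)
  show "g = h"
    using eq Comp_assoc[OF g m(2) n(2)] Comp_assoc[OF h m(2) n(2)]
      monic_cancel[OF n Comp_in_Hom[OF g m(2)] Comp_in_Hom[OF h m(2)]] monic_cancel[OF m g h]
    by simp
qed

section \<open>Kernels and cokernels\<close>

lemma is_kernelD:
  assumes "is_kernel C k f" "f \<in> Hom C X Y"
  shows "k \<in> Hom C (Dom C k) X" "f \<cdot> k = Zero C (Dom C k) Y"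
  using assms by (auto simp: is_kernel_def Hom_def)

lemma is_kernel_lift:
  assumes "is_kernel C k f" "f \<in> Hom C X Y" "h \<in> Hom C W X" "f \<cdot> h = Zero C W Y"
  obtains h' where "h' \<in> Hom C W (Dom C k)" "k \<cdot> h' = h"
proof -
  have "Dom C f = X" "Cod C f = Y" using assms(2) by (auto simp: Hom_def)
  then show ?thesis using assms that unfolding is_kernel_def by blast
qed

text \<open>Both \<open>g\<close> and \<open>h\<close> factor the same morphism
  \<open>k \<cdot> h\<close> through \<open>k\<close>, and the universal property makes such a
  factor unique.\<close>

lemma is_kernel_monic:
  assumes "is_kernel C k f"
  shows "monic C k"
proof -
  define X Y where "X = Dom C f" and "Y = Cod C f"
  have f: "f \<in> Hom C X Y" using assms by (simp add: is_kernel_def Hom_def X_def Y_def)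
  note k = is_kernelD[OF assms f]
  show ?thesis
    unfolding monic_def
  proof (intro conjI allI ballI impI)
    show "k \<in> Arr C" using k by (simp add: Hom_def)
    fix W g h assume g: "g \<in> Hom C W (Dom C k)" and h: "h \<in> Hom C W (Dom C k)"
      and eq: "k \<cdot> g = k \<cdot> h"
    have kh: "k \<cdot> h \<in> Hom C W X" using Comp_in_Hom[OF h k(1)] .
    have "f \<cdot> (k \<cdot> h) = Zero C W Y"
      using Comp_assoc[OF h k(1) f] k(2) Comp_Zero_left[OF h] Hom_Obj[OF f] by simp
    then have "\<exists>!h'. h' \<in> Hom C W (Dom C k) \<and> k \<cdot> h' = k \<cdot> h"
      using assms kh unfolding is_kernel_def X_def Y_def by blast
    then show "g = h" using g h eq by blast
  qed
qed

text \<open>For a monic \<open>k\<close> the uniqueness half of the universal property is automatic,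
  so only the existence of factors remains to be checked.\<close>

lemma is_kernelI:
  assumes f: "f \<in> Hom C X Y" and k: "k \<in> Hom C K X" "monic C k" and 0: "f \<cdot> k = Zero C K Y"
    and *: "\<And>W h. h \<in> Hom C W X \<Longrightarrow> f \<cdot> h = Zero C W Y \<Longrightarrow> \<exists>h'\<in>Hom C W K. k \<cdot> h' = h"
  shows "is_kernel C k f"
proof -
  have "\<exists>!h'. h' \<in> Hom C W K \<and> k \<cdot> h' = h" if "h \<in> Hom C W X" "f \<cdot> h = Zero C W Y" for W h
    using *[OF that] monic_cancel[OF k(2,1)] by metis
  moreover have "Dom C f = X" "Cod C f = Y" "Dom C k = K" "Cod C k = X" "f \<in> Arr C" "k \<in> Arr C"
    using f k by (auto simp: Hom_def)
  ultimately show ?thesis using 0 by (simp add: is_kernel_def)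
qed

end

section \<open>Epimorphisms, images and pullbacks in an abelian category\<close>

context abelian_category
begin

text \<open>The facts on kernels, read in the opposite category, become the corresponding facts on
  cokernels.\<close>

lemmas is_cokernelD = preadditive_category.is_kernelD
  [OF abelian_category.axioms(1)[OF abelian_op], simplified]
lemmas is_cokernel_lift = preadditive_category.is_kernel_lift
  [OF abelian_category.axioms(1)[OF abelian_op], simplified]
lemmas is_cokernel_epic = preadditive_category.is_kernel_monic
  [OF abelian_category.axioms(1)[OF abelian_op], simplified]
lemmas is_cokernelI = preadditive_category.is_kernelI
  [OF abelian_category.axioms(1)[OF abelian_op], simplified]

text \<open>The axiom gives \<open>e\<close> as a cokernel of some \<open>u\<close>. Since
  \<open>e\<close> kills \<open>u\<close>, \<open>u\<close> factors through \<open>k\<close>; so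
  whatever kills \<open>k\<close> also kills \<open>u\<close> and therefore factors through
  \<open>e\<close>.\<close>

lemma epic_is_cokernel_of_kernel:
  assumes e: "epic C e" and k: "is_kernel C k e"
  shows "is_cokernel C e k"
proof -
  obtain u where u: "is_cokernel C e u" using epic_is_cokernel[OF e] by blast
  define X Y U where "X = Dom C e" and "Y = Cod C e" and "U = Dom C u"
  have eH: "e \<in> Hom C X Y" and uH: "u \<in> Hom C U X"
    using u by (auto simp: is_cokernel_def Hom_def X_def Y_def U_def)
  note kD = is_kernelD[OF k eH]
  have "e \<cdot> u = Zero C U Y" using is_cokernelD(2)[OF u uH] by (simp add: Y_def)
  then obtain v where v: "v \<in> Hom C U (Dom C k)" "k \<cdot> v = u"
    using is_kernel_lift[OF k eH uH] by blast
  show ?thesis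
  proof (rule is_cokernelI[OF kD(1) eH e kD(2)])
    fix W h assume h: "h \<in> Hom C X W" and hk: "h \<cdot> k = Zero C (Dom C k) W"
    have "h \<cdot> u = Zero C U W"
      using Comp_assoc[OF v(1) kD(1) h] hk v Comp_Zero_left[OF v(1)] Hom_Obj[OF h] by simp
    then obtain h' where "h' \<in> Hom C (Cod C e) W" "h' \<cdot> e = h"
      using is_cokernel_lift[OF u uH h] by blast
    then show "\<exists>h'\<in>Hom C Y W. h' \<cdot> e = h" unfolding Y_def by blast
  qed
qed

text \<open>Here \<open>n\<close>, the kernel of the cokernel of \<open>c\<close>, is the image of
  \<open>c\<close>, and it is minimal. If \<open>x\<close> kills \<open>s\<close>, then
  \<open>c\<close> factors through \<open>n \<cdot> z\<close> with \<open>z\<close> the kernel of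
  \<open>x\<close>. This monomorphism is the kernel of some \<open>v\<close>, and \<open>v\<close>
  kills \<open>c\<close>, hence factors through \<open>t\<close> and kills \<open>n\<close>. So
  \<open>n\<close> factors through \<open>n \<cdot> z\<close>, which gives \<open>z\<close> a right
  inverse, and \<open>x \<cdot> z = 0\<close> forces \<open>x = 0\<close>.\<close>

lemma coimage_epic:
  assumes c: "c \<in> Hom C X Y" and t: "is_cokernel C t c" and n: "is_kernel C n t"
    and nH: "n \<in> Hom C I Y" and s: "s \<in> Hom C X I" and ns: "n \<cdot> s = c"
  shows "epic C s"
proof (rule epicI[OF s])
  note tD = is_cokernelD[OF t c]
  have tn: "t \<cdot> n = Zero C I (Cod C t)" using is_kernelD(2)[OF n tD(1)] nH by (simp add: Hom_def)
  fix W x assume x: "x \<in> Hom C I W" and xs: "x \<cdot> s = Zero C X W"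
  obtain z where z: "is_kernel C z x" using ex_kernel x by (auto simp: Hom_def)
  define Z where "Z = Dom C z"
  have zH: "z \<in> Hom C Z I" and xz: "x \<cdot> z = Zero C Z W"
    using is_kernelD[OF z x] by (auto simp: Z_def)
  obtain s' where s': "s' \<in> Hom C X Z" "z \<cdot> s' = s"
    using is_kernel_lift[OF z x s xs] by (auto simp: Z_def)
  have nzH: "n \<cdot> z \<in> Hom C Z Y" using Comp_in_Hom[OF zH nH] .
  have "monic C (n \<cdot> z)"
    using monic_Comp[OF is_kernel_monic[OF z] zH is_kernel_monic[OF n] nH] .
  then obtain v where v: "is_kernel C (n \<cdot> z) v" using monic_is_kernel by blast
  define V where "V = Cod C v"
  have vH: "v \<in> Hom C Y V" using v nzH by (auto simp: is_kernel_def Hom_def V_def)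
  have vnz: "v \<cdot> (n \<cdot> z) = Zero C Z V"
    using is_kernelD(2)[OF v vH] nzH by (simp add: Hom_def)
  have "v \<cdot> c = (v \<cdot> (n \<cdot> z)) \<cdot> s'"
    using ns s' Comp_assoc[OF s'(1) zH nH] Comp_assoc[OF s'(1) nzH vH] by simp
  also have "\<dots> = Zero C X V" using vnz Comp_Zero_left[OF s'(1)] Hom_Obj[OF vH] by simp
  finally obtain v' where v': "v' \<in> Hom C (Cod C t) V" "v' \<cdot> t = v"
    using is_cokernel_lift[OF t c vH] by blast
  have "v \<cdot> n = Zero C I V"
    using Comp_assoc[OF nH tD(1) v'(1)] v'(2) tn Comp_Zero_right[OF v'(1)] Hom_Obj[OF nH] by simp
  then obtain y where y': "y \<in> Hom C I (Dom C (n \<cdot> z))" "(n \<cdot> z) \<cdot> y = n"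
    using is_kernel_lift[OF v vH nH] by blast
  then have y: "y \<in> Hom C I Z" using nzH by (simp add: Hom_def)
  have id: "ident C I \<in> Hom C I I" using ident_in_Hom Hom_Obj[OF nH] by blast
  have "n \<cdot> (z \<cdot> y) = n \<cdot> ident C I"
    using y' Comp_assoc[OF y zH nH] Comp_ident_right[OF nH] by simp
  then have zy: "z \<cdot> y = ident C I"
    using monic_cancel[OF is_kernel_monic[OF n] nH Comp_in_Hom[OF y zH] id] by simp
  have "x = (x \<cdot> z) \<cdot> y"
    using zy Comp_assoc[OF y zH x] Comp_ident_right[OF x] by simp
  also have "\<dots> = Zero C I W" using xz Comp_Zero_left[OF y] Hom_Obj[OF x] by simp
  finally show "x = Zero C I W" .
qed

text \<open>Take \<open>n\<close> to be the kernel of \<open>t\<close>. As \<open>n\<close> is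
  monic, \<open>s\<close> and \<open>c\<close> have the same kernel; as \<open>s\<close> is epic,
  \<open>n\<close> and \<open>c\<close> have the same cokernel.\<close>

lemma image_factorization:
  assumes c: "c \<in> Hom C X Y" and j: "is_kernel C j c" and t: "is_cokernel C t c"
  obtains I n s where "n \<in> Hom C I Y" "s \<in> Hom C X I" "n \<cdot> s = c" "epic C s"
    "short_exact C j s" "short_exact C n t"
proof -
  note tD = is_cokernelD[OF t c] and jD = is_kernelD[OF j c]
  obtain n where n: "is_kernel C n t" using ex_kernel tD(1) by (auto simp: Hom_def)
  define I where "I = Dom C n"
  have nH: "n \<in> Hom C I Y" and tn: "t \<cdot> n = Zero C I (Cod C t)"
    using is_kernelD[OF n tD(1)] by (auto simp: I_def)
  obtain s where s: "s \<in> Hom C X I" "n \<cdot> s = c"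
    using is_kernel_lift[OF n tD(1) c tD(2)] by (auto simp: I_def)
  have es: "epic C s" using coimage_epic[OF c t n nH s] .
  have "is_kernel C j s"
  proof (rule is_kernelI[OF s(1) jD(1) is_kernel_monic[OF j]])
    have "n \<cdot> (s \<cdot> j) = Zero C (Dom C j) Y" using Comp_assoc[OF jD(1) s(1) nH] s(2) jD(2) by simp
    then show "s \<cdot> j = Zero C (Dom C j) I"
      using monic_zero[OF is_kernel_monic[OF n] nH Comp_in_Hom[OF jD(1) s(1)]] by simp
    fix W h assume h: "h \<in> Hom C W X" "s \<cdot> h = Zero C W I"
    then have "c \<cdot> h = Zero C W Y"
      using Comp_assoc[OF h(1) s(1) nH] s(2) Comp_Zero_right[OF nH] Hom_Obj[OF h(1)] by simp
    then show "\<exists>h'\<in>Hom C W (Dom C j). j \<cdot> h' = h" using is_kernel_lift[OF j c h(1)] by blast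
  qed
  then have 1: "short_exact C j s"
    using epic_is_cokernel_of_kernel[OF es] by (simp add: short_exact_def)
  have "is_cokernel C t n"
  proof (rule is_cokernelI[OF nH tD(1) is_cokernel_epic[OF t] tn])
    fix W h assume h: "h \<in> Hom C Y W" "h \<cdot> n = Zero C I W"
    then have "h \<cdot> c = Zero C X W"
      using Comp_assoc[OF s(1) nH h(1)] s(2) Comp_Zero_left[OF s(1)] Hom_Obj[OF h(1)] by simp
    then show "\<exists>h'\<in>Hom C (Cod C t) W. h' \<cdot> t = h" using is_cokernel_lift[OF t c h(1)] by blast
  qed
  then have "short_exact C n t" using n by (simp add: short_exact_def)
  then show ?thesis using that nH s es 1 by blast
qed

text \<open>The map \<open>e\<close> minus \<open>w\<close> is an epimorphism on \<open>X \<oplus> Y\<close>, hence the cokernel of its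
  kernel, and a map \<open>h\<close> killing \<open>b\<close>, precomposed with the projection to \<open>Y\<close>, factors
  through it.\<close>

lemma epic_pullback:
  assumes e: "epic C e" "e \<in> Hom C X Z" and w: "w \<in> Hom C Y Z"
    and a: "a \<in> Hom C L X" and b: "b \<in> Hom C L Y"
    and pb: "\<And>W x y. x \<in> Hom C W X \<Longrightarrow> y \<in> Hom C W Y \<Longrightarrow> e \<cdot> x = w \<cdot> y \<Longrightarrow>
      \<exists>z\<in>Hom C W L. a \<cdot> z = x \<and> b \<cdot> z = y"
  shows "epic C b"
proof (rule epicI[OF b])
  fix W h assume h: "h \<in> Hom C Y W" and hb: "h \<cdot> b = Zero C L W"
  obtain w' where w': "w' \<in> Hom C Y Z" "w \<boxplus> w' = Zero C Y Z" using ex_neg[OF w] .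
  obtain P i1 i2 p1 p2 where "is_biproduct C X Y P i1 i2 p1 p2"
    using ex_biproduct[of X Y] Hom_Obj[OF e(2)] Hom_Obj[OF w] by blast
  then have i1: "i1 \<in> Hom C X P" and i2: "i2 \<in> Hom C Y P"
    and p1: "p1 \<in> Hom C P X" and p2: "p2 \<in> Hom C P Y"
    and p1i1: "p1 \<cdot> i1 = ident C X" and p2i2: "p2 \<cdot> i2 = ident C Y"
    and p1i2: "p1 \<cdot> i2 = Zero C Y X" and p2i1: "p2 \<cdot> i1 = Zero C X Y"
    by (auto simp: is_biproduct_def)
  note obj = Hom_Obj[OF e(2)] Hom_Obj[OF w] Hom_Obj[OF h] Hom_Obj[OF p1] Hom_Obj[OF b]
  define \<phi> where "\<phi> = (e \<cdot> p1) \<boxplus> (w' \<cdot> p2)"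
  have ep1: "e \<cdot> p1 \<in> Hom C P Z" and wp2: "w' \<cdot> p2 \<in> Hom C P Z" and hp2: "h \<cdot> p2 \<in> Hom C P W"
    using Comp_in_Hom p1 p2 e(2) w'(1) h by blast+
  have \<phi>: "\<phi> \<in> Hom C P Z" using Add_in_Hom[OF ep1 wp2] by (simp add: \<phi>_def)
  have \<phi>i1: "\<phi> \<cdot> i1 = e"
    using Comp_Add_left[OF i1 ep1 wp2] Comp_assoc[OF i1 p1 e(2)] Comp_assoc[OF i1 p2 w'(1)]
      p1i1 p2i1 Comp_ident_right[OF e(2)] Comp_Zero_right[OF w'(1)] Add_Zero[OF e(2)] obj
    by (simp add: \<phi>_def)
  \<comment> \<open>Restricting \<open>\<phi>\<close> along \<open>i1\<close> gives back the
    epimorphism \<open>e\<close>, so a morphism that kills \<open>\<phi>\<close> kills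
    \<open>e\<close>.\<close>
  have "epic C \<phi>"
  proof (rule epicI[OF \<phi>])
    fix V x assume x: "x \<in> Hom C Z V" and x\<phi>: "x \<cdot> \<phi> = Zero C P V"
    have "x \<cdot> e = Zero C X V"
      using Comp_assoc[OF i1 \<phi> x] x\<phi> \<phi>i1 Comp_Zero_left[OF i1] Hom_Obj[OF x] by simp
    then show "x = Zero C Z V" using epic_zero[OF e x] by simp
  qed
  obtain k where k: "is_kernel C k \<phi>" using ex_kernel \<phi> by (auto simp: Hom_def)
  define K where "K = Dom C k"
  have kH: "k \<in> Hom C K P" and \<phi>k: "\<phi> \<cdot> k = Zero C K Z"
    using is_kernelD[OF k \<phi>] by (auto simp: K_def)
  have x: "p1 \<cdot> k \<in> Hom C K X" and y: "p2 \<cdot> k \<in> Hom C K Y"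
    using Comp_in_Hom kH p1 p2 by blast+
  have ex: "e \<cdot> (p1 \<cdot> k) \<in> Hom C K Z" and wy: "w \<cdot> (p2 \<cdot> k) \<in> Hom C K Z"
    and w'y: "w' \<cdot> (p2 \<cdot> k) \<in> Hom C K Z"
    using Comp_in_Hom x y e(2) w w'(1) by blast+
  \<comment> \<open>Since \<open>w'\<close> is the negative of \<open>w\<close>, the vanishing of
    \<open>\<phi> \<cdot> k\<close> says that the two components of \<open>k\<close> have equal
    images under \<open>e\<close> and \<open>w\<close>. So \<open>pb\<close> applies to them, and
    \<open>p2 \<cdot> k\<close> factors through \<open>b\<close>, which \<open>h\<close>
    kills.\<close>
  have "(e \<cdot> (p1 \<cdot> k)) \<boxplus> (w' \<cdot> (p2 \<cdot> k)) = Zero C K Z"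
    using \<phi>k Comp_Add_left[OF kH ep1 wp2] Comp_assoc[OF kH p1 e(2)] Comp_assoc[OF kH p2 w'(1)]
    by (simp add: \<phi>_def)
  moreover have "(w \<cdot> (p2 \<cdot> k)) \<boxplus> (w' \<cdot> (p2 \<cdot> k)) = Zero C K Z"
    using Comp_Add_left[OF y w w'(1)] w'(2) Comp_Zero_left[OF y] obj by simp
  ultimately have "e \<cdot> (p1 \<cdot> k) = w \<cdot> (p2 \<cdot> k)" using Add_right_cancel[OF ex wy w'y] by simp
  then obtain z where z: "z \<in> Hom C K L" "b \<cdot> z = p2 \<cdot> k" using pb[OF x y] by blast
  have "(h \<cdot> p2) \<cdot> k = (h \<cdot> b) \<cdot> z"
    using Comp_assoc[OF kH p2 h] Comp_assoc[OF z(1) b h] z(2) by simp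
  also have "\<dots> = Zero C K W" using hb Comp_Zero_left[OF z(1)] obj by simp
  finally have "(h \<cdot> p2) \<cdot> k = Zero C K W" .
  then obtain t where t: "t \<in> Hom C (Cod C \<phi>) W" "t \<cdot> \<phi> = h \<cdot> p2"
    using is_cokernel_lift[OF epic_is_cokernel_of_kernel[OF \<open>epic C \<phi>\<close> k] kH hp2] by blast
  have tH: "t \<in> Hom C Z W" using t(1) \<phi> by (simp add: Hom_def)
  \<comment> \<open>The factor \<open>t\<close> is zero: on the summand \<open>X\<close> it becomes
    \<open>t \<cdot> e\<close>, while \<open>h \<cdot> p2\<close> vanishes there. Hence
    \<open>h \<cdot> p2 = 0\<close>, and \<open>i2\<close> recovers \<open>h\<close>.\<close>
  have "t \<cdot> e = (h \<cdot> p2) \<cdot> i1" using Comp_assoc[OF i1 \<phi> tH] t(2) \<phi>i1 by simp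
  also have "\<dots> = Zero C X W"
    using Comp_assoc[OF i1 p2 h] p2i1 Comp_Zero_right[OF h] obj by simp
  finally have "t = Zero C Z W" using epic_zero[OF e tH] by simp
  then have "h \<cdot> p2 = Zero C P W" using t(2) Comp_Zero_left[OF \<phi>] obj by simp
  then have "(h \<cdot> p2) \<cdot> i2 = Zero C Y W" using Comp_Zero_left[OF i2] obj by simp
  then show "h = Zero C Y W"
    using Comp_assoc[OF i2 p2 h] p2i2 Comp_ident_right[OF h] by simp
qed

section \<open>The kernel-cokernel sequence of a composite\<close>

text \<open>The monomorphism \<open>m \<cdot> j\<close> presents \<open>Dom C j\<close> as the
  intersection of the kernel of \<open>g\<close> with the image of \<open>f\<close>. The map
  \<open>b\<close> is the restriction of \<open>f\<close> to the kernel of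
  \<open>g \<cdot> f\<close>; it reaches all of this intersection, and its kernel is that of
  \<open>f\<close>.\<close>

lemma ker_comp_short_exact:
  assumes f: "f \<in> Hom C A B" and g: "g \<in> Hom C B D"
    and k: "is_kernel C k f" and l: "is_kernel C l (g \<cdot> f)" and m: "is_kernel C m g"
    and p: "is_cokernel C p f" and j: "is_kernel C j (p \<cdot> m)"
  obtains a b where "a \<in> Hom C (Dom C k) (Dom C l)" "b \<in> Hom C (Dom C l) (Dom C j)"
    "short_exact C a b"
proof -
  define K L M J P where "K = Dom C k" and "L = Dom C l" and "M = Dom C m" and "J = Dom C j"
    and "P = Cod C p"
  have gf: "g \<cdot> f \<in> Hom C A D" using Comp_in_Hom f g by blast
  have kH: "k \<in> Hom C K A" "f \<cdot> k = Zero C K B" using is_kernelD[OF k f] by (auto simp: K_def)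
  have lH: "l \<in> Hom C L A" "(g \<cdot> f) \<cdot> l = Zero C L D" using is_kernelD[OF l gf] by (auto simp: L_def)
  have mH: "m \<in> Hom C M B" "g \<cdot> m = Zero C M D" using is_kernelD[OF m g] by (auto simp: M_def)
  have pH: "p \<in> Hom C B P" "p \<cdot> f = Zero C A P" using is_cokernelD[OF p f] by (auto simp: P_def)
  have pm: "p \<cdot> m \<in> Hom C M P" using Comp_in_Hom mH pH by blast
  have jH: "j \<in> Hom C J M" "(p \<cdot> m) \<cdot> j = Zero C J P" using is_kernelD[OF j pm] by (auto simp: J_def)
  note mono = is_kernel_monic[OF k] is_kernel_monic[OF l] is_kernel_monic[OF m] is_kernel_monic[OF j]
  note obj = Hom_Obj[OF f] Hom_Obj[OF g] Hom_Obj[OF kH(1)] Hom_Obj[OF lH(1)] Hom_Obj[OF mH(1)]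
    Hom_Obj[OF pH(1)] Hom_Obj[OF jH(1)]
  have fl: "f \<cdot> l \<in> Hom C L B" using Comp_in_Hom lH f by blast
  have mj: "m \<cdot> j \<in> Hom C J B" using Comp_in_Hom jH mH by blast
  have mj_mono: "monic C (m \<cdot> j)" using monic_Comp[OF mono(4) jH(1) mono(3) mH(1)] .
  have pmj: "p \<cdot> (m \<cdot> j) = Zero C J P" using Comp_assoc[OF jH(1) mH(1) pH(1)] jH(2) by simp
  have gmj: "g \<cdot> (m \<cdot> j) = Zero C J D"
    using Comp_assoc[OF jH(1) mH(1) g] mH(2) Comp_Zero_left[OF jH(1)] obj by simp

  have "(g \<cdot> f) \<cdot> k = Zero C K D"
    using Comp_assoc[OF kH(1) f g] kH(2) Comp_Zero_right[OF g] obj by simp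
  then obtain a where a: "a \<in> Hom C K L" "l \<cdot> a = k"
    using is_kernel_lift[OF l gf kH(1)] by (auto simp: L_def)
  have "g \<cdot> (f \<cdot> l) = Zero C L D" using Comp_assoc[OF lH(1) f g] lH(2) by simp
  then obtain b0 where b0: "b0 \<in> Hom C L M" "m \<cdot> b0 = f \<cdot> l"
    using is_kernel_lift[OF m g fl] by (auto simp: M_def)
  \<comment> \<open>The restriction \<open>b0\<close> of \<open>f\<close> lands in the kernel of
    \<open>g\<close>; because \<open>p\<close> kills \<open>f\<close>, it lands even in the kernel
    \<open>j\<close> of \<open>p \<cdot> m\<close>.\<close>
  have "(p \<cdot> m) \<cdot> b0 = (p \<cdot> f) \<cdot> l"
    using Comp_assoc[OF b0(1) mH(1) pH(1)] Comp_assoc[OF lH(1) f pH(1)] b0(2) by simp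
  also have "\<dots> = Zero C L P" using pH(2) Comp_Zero_left[OF lH(1)] obj by simp
  finally obtain b where b: "b \<in> Hom C L J" "j \<cdot> b = b0"
    using is_kernel_lift[OF j pm b0(1)] by (auto simp: J_def)
  have mjb: "(m \<cdot> j) \<cdot> b = f \<cdot> l" using Comp_assoc[OF b(1) jH(1) mH(1)] b b0 by simp

  \<comment> \<open>As \<open>m \<cdot> j\<close> is monic and carries \<open>b\<close> to
    \<open>f \<cdot> l\<close>, the kernel of \<open>b\<close> can be computed from
    \<open>f\<close>.\<close>
  have ker_b: "b \<cdot> x = Zero C W J \<longleftrightarrow> f \<cdot> (l \<cdot> x) = Zero C W B" if x: "x \<in> Hom C W L" for W x
  proof -
    have eq: "f \<cdot> (l \<cdot> x) = (m \<cdot> j) \<cdot> (b \<cdot> x)"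
      using Comp_assoc[OF x b(1) mj] Comp_assoc[OF x lH(1) f] mjb by simp
    have bx: "b \<cdot> x \<in> Hom C W J" using Comp_in_Hom[OF x b(1)] .
    have mj0: "(m \<cdot> j) \<cdot> Zero C W J = Zero C W B" using Comp_Zero_right[OF mj] Hom_Obj[OF x] by blast
    show ?thesis
    proof
      assume "b \<cdot> x = Zero C W J"
      then show "f \<cdot> (l \<cdot> x) = Zero C W B" using eq mj0 by (simp only:)
    next
      assume "f \<cdot> (l \<cdot> x) = Zero C W B"
      then show "b \<cdot> x = Zero C W J" using eq monic_zero[OF mj_mono mj bx] by (simp only:)
    qed
  qed
  have kb: "is_kernel C a b"
  proof (rule is_kernelI[OF b(1) a(1)])
    show "monic C a"
      unfolding monic_def
    proof (intro conjI allI ballI impI)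
      show "a \<in> Arr C" using a by (simp add: Hom_def)
      fix W x y assume "x \<in> Hom C W (Dom C a)" "y \<in> Hom C W (Dom C a)" and eq: "a \<cdot> x = a \<cdot> y"
      then have x: "x \<in> Hom C W K" and y: "y \<in> Hom C W K" using a(1) by (auto simp: Hom_def)
      have "k \<cdot> x = k \<cdot> y"
        using eq Comp_assoc[OF x a(1) lH(1)] Comp_assoc[OF y a(1) lH(1)] a(2) by simp
      then show "x = y" using monic_cancel[OF mono(1) kH(1) x y] by simp
    qed
    show "b \<cdot> a = Zero C K J" using ker_b[OF a(1)] a(2) kH(2) by simp
    fix W x assume x: "x \<in> Hom C W L" and "b \<cdot> x = Zero C W J"
    then have "f \<cdot> (l \<cdot> x) = Zero C W B" using ker_b by blast
    then obtain y where y: "y \<in> Hom C W K" "k \<cdot> y = l \<cdot> x"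
      using is_kernel_lift[OF k f Comp_in_Hom[OF x lH(1)]] by (auto simp: K_def)
    then have "l \<cdot> (a \<cdot> y) = l \<cdot> x" using Comp_assoc[OF y(1) a(1) lH(1)] a(2) by simp
    then show "\<exists>y\<in>Hom C W K. a \<cdot> y = x"
      using monic_cancel[OF mono(2) lH(1) Comp_in_Hom[OF y(1) a(1)] x] y(1) by blast
  qed

  \<comment> \<open>For \<open>b\<close> to be epic: \<open>e\<close> is the epimorphism of
    \<open>A\<close> onto the image \<open>i\<close> of \<open>f\<close>, and
    \<open>m \<cdot> j\<close> factors through \<open>i\<close> by \<open>w\<close> since
    \<open>p\<close> kills it. The maps \<open>l\<close> and \<open>b\<close> are a pullback of
    \<open>e\<close> and \<open>w\<close>, so \<open>b\<close> inherits epicness from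
    \<open>e\<close>.\<close>
  obtain I i e where i: "i \<in> Hom C I B" and e: "e \<in> Hom C A I" "i \<cdot> e = f" "epic C e"
    and "short_exact C i p"
    using image_factorization[OF f k p] by blast
  then have ip: "is_kernel C i p" by (simp add: short_exact_def)
  obtain w where w: "w \<in> Hom C J I" "i \<cdot> w = m \<cdot> j"
    using is_kernel_lift[OF ip pH(1) mj pmj] i by (auto simp: Hom_def)
  have "epic C b"
  proof (rule epic_pullback[OF e(3,1) w(1) lH(1) b(1)])
    fix W x y assume x: "x \<in> Hom C W A" and y: "y \<in> Hom C W J" and eq: "e \<cdot> x = w \<cdot> y"
    \<comment> \<open>Since \<open>f \<cdot> x\<close> factors through \<open>m \<cdot> j\<close>,
      it is killed by \<open>g\<close>, so \<open>x\<close> lifts along \<open>l\<close>. Cancelling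
      \<open>m \<cdot> j\<close> shows that \<open>b\<close> sends the lift to
      \<open>y\<close>.\<close>
    have fx: "f \<cdot> x = (m \<cdot> j) \<cdot> y"
      using eq Comp_assoc[OF x e(1) i] Comp_assoc[OF y w(1) i] e(2) w(2) by simp
    then have "(g \<cdot> f) \<cdot> x = Zero C W D"
      using Comp_assoc[OF x f g] Comp_assoc[OF y mj g] gmj Comp_Zero_left[OF y] obj by simp
    then obtain z where z: "z \<in> Hom C W L" "l \<cdot> z = x"
      using is_kernel_lift[OF l gf x] by (auto simp: L_def)
    have "(m \<cdot> j) \<cdot> (b \<cdot> z) = (m \<cdot> j) \<cdot> y"
      using Comp_assoc[OF z(1) b(1) mj] Comp_assoc[OF z(1) lH(1) f] mjb z(2) fx by simp
    then have "b \<cdot> z = y" using monic_cancel[OF mj_mono mj Comp_in_Hom[OF z(1) b(1)] y] by simp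
    then show "\<exists>z\<in>Hom C W L. l \<cdot> z = x \<and> b \<cdot> z = y" using z by blast
  qed
  then have "short_exact C a b"
    using kb epic_is_cokernel_of_kernel by (simp add: short_exact_def)
  then show ?thesis using that a(1) b(1) by (simp add: K_def L_def J_def)
qed

text \<open>In the opposite category \<open>g\<close> and \<open>f\<close> change places, as do
  \<open>m\<close> and \<open>p\<close>. The middle map \<open>p \<cdot> m\<close> stays the same,
  but its kernel is replaced by its cokernel.\<close>

lemmas cok_comp_short_exact =
  abelian_category.ker_comp_short_exact[OF abelian_op, simplified]

end

section \<open>The index of a composite\<close>

lemma is_kernel_SOME:
  assumes "abelian_category C" "f \<in> Arr C"
  shows "is_kernel C (SOME k. is_kernel C k f) f"
  using abelian_category.ex_kernel[OF assms] by (rule someI_ex)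

lemma is_cokernel_SOME:
  assumes "abelian_category C" "f \<in> Arr C"
  shows "is_cokernel C (SOME q. is_cokernel C q f) f"
  using abelian_category.ex_cokernel[OF assms] by (rule someI_ex)

theorem theorem4:
  fixes C :: "('o, 'm) preadd_category"
    and S :: "'o set"
    and len :: "'o \<Rightarrow> 'a::ab_group_add"
  assumes "abelian_category C"
    and "serre_subcategory C S"
    and "length_function C S len"
    and "f \<in> Hom C A B"
    and "g \<in> Hom C B D"
    and "Fredholm C S f"
    and "Fredholm C S g"
    and "Fredholm C S (g \<cdot>\<^bsub>C\<^esub> f)"
  shows "ind C len (g \<cdot>\<^bsub>C\<^esub> f) = ind C len f + ind C len g"
proof -
  interpret abelian_category C by fact
  note f = assms(4) and g = assms(5)
  have gf: "g \<cdot>\<^bsub>C\<^esub> f \<in> Hom C A D" using Comp_in_Hom f g by blast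
  have arr: "f \<in> Arr C" "g \<in> Arr C" "g \<cdot>\<^bsub>C\<^esub> f \<in> Arr C" using f g gf by (auto simp: Hom_def)
  note kers = arr[THEN is_kernel_SOME[OF assms(1)]]
    and coks = arr[THEN is_cokernel_SOME[OF assms(1)]]
  \<comment> \<open>The chosen representatives themselves serve as kernels and cokernels, so no
    length has to be transported along an isomorphism.\<close>
  obtain k l m where k: "is_kernel C k f" "Dom C k = ker C f"
    and l: "is_kernel C l (g \<cdot>\<^bsub>C\<^esub> f)" "Dom C l = ker C (g \<cdot>\<^bsub>C\<^esub> f)"
    and m: "is_kernel C m g" "Dom C m = ker C g"
    using kers unfolding ker_def by blast
  obtain p q r where p: "is_cokernel C p f" "Cod C p = cok C f"
    and q: "is_cokernel C q (g \<cdot>\<^bsub>C\<^esub> f)" "Cod C q = cok C (g \<cdot>\<^bsub>C\<^esub> f)"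
    and r: "is_cokernel C r g" "Cod C r = cok C g"
    using coks unfolding cok_def by blast
  have inS: "ker C f \<in> S" "ker C g \<in> S" "ker C (g \<cdot>\<^bsub>C\<^esub> f) \<in> S"
    "cok C f \<in> S" "cok C g \<in> S" "cok C (g \<cdot>\<^bsub>C\<^esub> f) \<in> S"
    using assms(6-8) by (auto simp: Fredholm_def)

  have mH: "m \<in> Hom C (ker C g) B" using is_kernelD(1)[OF m(1) g] m(2) by simp
  have pH: "p \<in> Hom C B (cok C f)" using is_cokernelD(1)[OF p(1) f] p(2) by simp
  have pm: "p \<cdot>\<^bsub>C\<^esub> m \<in> Hom C (ker C g) (cok C f)" using Comp_in_Hom mH pH by blast
  then have pm_arr: "p \<cdot>\<^bsub>C\<^esub> m \<in> Arr C" by (simp add: Hom_def)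
  obtain j where j: "is_kernel C j (p \<cdot>\<^bsub>C\<^esub> m)" using ex_kernel[OF pm_arr] by blast
  obtain t where t: "is_cokernel C t (p \<cdot>\<^bsub>C\<^esub> m)" using ex_cokernel[OF pm_arr] by blast
  define J T where "J = Dom C j" and "T = Cod C t"
  have jH: "j \<in> Hom C J (ker C g)" using is_kernelD(1)[OF j pm] by (simp add: J_def)
  have tH: "t \<in> Hom C (cok C f) T" using is_cokernelD(1)[OF t pm] by (simp add: T_def)

  obtain a b where ab: "a \<in> Hom C (ker C f) (ker C (g \<cdot>\<^bsub>C\<^esub> f))" "b \<in> Hom C (ker C (g \<cdot>\<^bsub>C\<^esub> f)) J"
    "short_exact C a b"
    using ker_comp_short_exact[OF f g k(1) l(1) m(1) p(1) j] k(2) l(2) by (auto simp: J_def)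
  \<comment> \<open>Arrows are reversed here: \<open>d\<close> takes the place of \<open>a\<close>
    and \<open>c\<close> that of \<open>b\<close>, which gives the last of the four
    sequences.\<close>
  obtain d c where cd: "d \<in> Hom C (cok C (g \<cdot>\<^bsub>C\<^esub> f)) (cok C g)" "c \<in> Hom C T (cok C (g \<cdot>\<^bsub>C\<^esub> f))"
    "short_exact C c d"
    using cok_comp_short_exact[OF g f r(1) q(1) p(1) m(1) t] r(2) q(2) by (auto simp: T_def)
  obtain I n s where n: "n \<in> Hom C I (cok C f)" and s: "s \<in> Hom C (ker C g) I" "epic C s"
    and js: "short_exact C j s" and nt: "short_exact C n t"
    using image_factorization[OF pm j t] by blast

  have sub: "X \<in> S" if "monic C u" "u \<in> Hom C X Y" "Y \<in> S" for u X Y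
    using assms(2) that unfolding serre_subcategory_def Hom_def by blast
  have quot: "Y \<in> S" if "epic C u" "u \<in> Hom C X Y" "X \<in> S" for u X Y
    using assms(2) that unfolding serre_subcategory_def Hom_def by blast
  have J: "J \<in> S" using sub[OF is_kernel_monic[OF j] jH inS(2)] .
  have I: "I \<in> S" using quot[OF s(2,1) inS(2)] .
  have T: "T \<in> S" using quot[OF is_cokernel_epic[OF t] tH inS(4)] .
  have len: "len Y = len X + len Z"
    if "short_exact C u v" "u \<in> Hom C X Y" "v \<in> Hom C Y Z" "X \<in> S" "Y \<in> S" "Z \<in> S" for u v X Y Z
    using assms(3) that unfolding length_function_def Hom_def by blast
  have "len (ker C (g \<cdot>\<^bsub>C\<^esub> f)) = len (ker C f) + len J"
    using len[OF ab(3,1,2)] inS J by simp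
  moreover have "len (ker C g) = len J + len I" using len[OF js jH s(1)] inS J I by simp
  moreover have "len (cok C f) = len I + len T" using len[OF nt n tH] inS I T by simp
  moreover have "len (cok C (g \<cdot>\<^bsub>C\<^esub> f)) = len T + len (cok C g)"
    using len[OF cd(3,2,1)] inS T by simp
  \<comment> \<open>The contributions of \<open>I\<close> to \<open>cok C f\<close> and
    \<open>ker C g\<close> cancel, and both sides equal
    \<open>len T + len (cok C g) - len (ker C f) - len J\<close>.\<close>
  ultimately show ?thesis unfolding ind_def by (simp add: algebra_simps)
qed

end
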